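(* Let $G$ be a finite abelian group of odd order. Then $G$ contains no nontrivial sum set.
   Context: Let $G$ be a finite group of order $v$ and $S \subseteq G$ with $|S| = k$. For $a \in G$, the number of ways to write $a$ as a product in $S$ is the number of ordered pairs $(x,y) \in S\times S$ with $xy = a$. $S$ is a $(v,k,\mu)$ sum set if every nonidentity element of $G$ can be written as a product in $S$ in exactly $\mu$ ways. The trivial sum sets are $\varnothing$, $G$, the singletons $\{g\}$ with $g^2 = 1$, and their complements $G \setminus \{g\}$ with $g^2=1$; a sum set is nontrivial if it is not one of these. *)

theory Defs
  imports "HOL-Algebra.Coset"
begin

text \<open>
  The definitions below are meant for a finite group \<open>G\<close>. Finiteness matters, since \<^const>\<open>card\<close> and
  \<^const>\<open>order\<close> return 0 on infinite sets.
\<close>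

definition product_count :: "('a, 'b) monoid_scheme \<Rightarrow> 'a set \<Rightarrow> 'a \<Rightarrow> nat" where
  "product_count G S a = card {(x, y). x \<in> S \<and> y \<in> S \<and> x \<otimes>\<^bsub>G\<^esub> y = a}"

definition sum_set_params ::
    "('a, 'b) monoid_scheme \<Rightarrow> nat \<Rightarrow> nat \<Rightarrow> nat \<Rightarrow> 'a set \<Rightarrow> bool" where
  "sum_set_params G v k \<mu> S \<longleftrightarrow>
     order G = v \<and> S \<subseteq> carrier G \<and> card S = k \<and>
     (\<forall>a \<in> carrier G - {\<one>\<^bsub>G\<^esub>}. product_count G S a = \<mu>)"

definition sum_set :: "('a, 'b) monoid_scheme \<Rightarrow> 'a set \<Rightarrow> bool" where
  "sum_set G S \<longleftrightarrow> (\<exists>v k \<mu>. sum_set_params G v k \<mu> S)"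

definition trivial_sum_set :: "('a, 'b) monoid_scheme \<Rightarrow> 'a set \<Rightarrow> bool" where
  "trivial_sum_set G S \<longleftrightarrow>
     S = {} \<or> S = carrier G \<or>
     (\<exists>g \<in> carrier G. g \<otimes>\<^bsub>G\<^esub> g = \<one>\<^bsub>G\<^esub> \<and> (S = {g} \<or> S = carrier G - {g}))"

definition nontrivial_sum_set :: "('a, 'b) monoid_scheme \<Rightarrow> 'a set \<Rightarrow> bool" where
  "nontrivial_sum_set G S \<longleftrightarrow> sum_set G S \<and> \<not> trivial_sum_set G S"

end

theory Submission
  imports Defs "HOL-Algebra.Multiplicative_Group"
begin

text \<open>
  In an abelian group the ordered factorisations \<open>x y = a\<close> over \<open>S\<close> are paired off by
  swapping \<open>x\<close> and \<open>y\<close>, except those with \<open>x = y\<close>. In odd order every element has exactly one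
  square root, so the number of factorisations of \<open>b\<^sup>2\<close> is odd precisely when \<open>b \<in> S\<close>. For a sum
  set this number is the same for all \<open>b \<noteq> 1\<close>, hence \<open>S\<close> contains either all nonidentity elements
  or none of them.
\<close>

text \<open>The orbits \<open>{x, f x}\<close> partition \<open>A\<close>, and each has exactly two
  elements because \<open>f\<close> has no fixed point.\<close>

lemma even_card_involution:
  assumes "finite A" and "\<And>x. x \<in> A \<Longrightarrow> f x \<in> A"
    and "\<And>x. x \<in> A \<Longrightarrow> f (f x) = x" and "\<And>x. x \<in> A \<Longrightarrow> f x \<noteq> x"
  shows "even (card A)"
proof -
  let ?C = "(\<lambda>x. {x, f x}) ` A"
  have "\<Union>?C = A"
    using assms(2) by auto
  moreover have "2 * card ?C = card (\<Union>?C)"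
  proof (rule card_partition)
    show "card c = 2" if "c \<in> ?C" for c
      using that assms(4) by (auto simp: card_2_iff)
    show "c \<inter> d = {}" if cd: "c \<in> ?C" "d \<in> ?C" "c \<noteq> d" for c d
    proof -
      obtain x y where xy: "x \<in> A" "c = {x, f x}" "y \<in> A" "d = {y, f y}"
        using cd by blast
      then have "f (f x) = x" "f (f y) = y"
        using assms(3) by blast+
      then have "x \<noteq> y \<and> x \<noteq> f y \<and> f x \<noteq> y \<and> f x \<noteq> f y"
        using cd(3) xy(2,4) by (metis insert_commute)
      then show ?thesis
        unfolding xy(2,4) by blast
    qed
  qed (use assms(1) in auto)
  ultimately show ?thesis
    using dvd_triv_left by metis
qed

text \<open>With order \<open>2 * m + 1\<close>, both \<open>x [^] (2 * m)\<close> and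
  \<open>x [^] (2 * m + 1)\<close> are the identity, hence so is \<open>x\<close>.\<close>

lemma (in group) square_eq_one_odd_order:
  assumes "odd (order G)" and "x \<in> carrier G" and "x \<otimes> x = \<one>"
  shows "x = \<one>"
proof -
  obtain m where m: "order G = 2 * m + 1"
    using assms(1) by (rule oddE)
  have "x [^] (2::nat) = \<one>"
    using assms(2,3) by (simp add: numeral_2_eq_2)
  then have "x [^] (2 * m) = \<one>"
    using assms(2) nat_pow_pow[of x 2 m] by simp
  then show ?thesis
    using pow_order_eq_1[OF assms(2)] assms(2) m by simp
qed

text \<open>Commutativity makes squaring a homomorphism, so its trivial kernel gives
  injectivity.\<close>

lemma (in comm_group) square_inj_odd_order:
  assumes "odd (order G)" and "x \<in> carrier G" and "y \<in> carrier G" and "x \<otimes> x = y \<otimes> y"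
  shows "x = y"
proof -
  have "(x \<otimes> inv y) \<otimes> (x \<otimes> inv y) = (x \<otimes> x) \<otimes> inv (y \<otimes> y)"
    using assms(2,3) by (simp add: inv_mult m_ac)
  also have "\<dots> = \<one>"
    using assms(3,4) by simp
  finally have "x \<otimes> inv y = \<one>"
    by (rule square_eq_one_odd_order[OF assms(1) m_closed[OF assms(2) inv_closed[OF assms(3)]]])
  then show ?thesis
    using assms(2,3) inv_equality[of x "inv y"] by simp
qed

lemma (in comm_group) odd_product_count_square_iff:
  assumes "finite (carrier G)" and "odd (order G)" and "S \<subseteq> carrier G" and "b \<in> carrier G"
  shows "odd (product_count G S (b \<otimes> b)) \<longleftrightarrow> b \<in> S"
proof -
  let ?P = "{(x, y). x \<in> S \<and> y \<in> S \<and> x \<otimes> y = b \<otimes> b}"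
  \<comment> \<open>These are the fixed points of the swap on \<open>?P\<close>: the pair
    \<open>(b, b)\<close> if \<open>b\<close> lies in \<open>S\<close>, and nothing
    otherwise.\<close>
  let ?D = "{(b, b)} \<inter> S \<times> S"
  have fin: "finite ?P"
    by (rule finite_subset[of _ "carrier G \<times> carrier G"]) (use assms in auto)
  have D: "x = b" if "x \<in> S" "x \<otimes> x = b \<otimes> b" for x
    by (rule square_inj_odd_order) (use assms that in auto)
  have "even (card (?P - ?D))"
  proof (rule even_card_involution[where f = prod.swap])
    show "prod.swap p \<in> ?P - ?D" if "p \<in> ?P - ?D" for p
      using that assms(3) by (auto simp: m_comm subset_iff)
    show "prod.swap p \<noteq> p" if "p \<in> ?P - ?D" for p
    proof (cases p)
      case (Pair x y)
      have xy: "x \<in> S" "y \<in> S" "x \<otimes> y = b \<otimes> b" "x \<noteq> b \<or> y \<noteq> b"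
        using that Pair by auto
      have "x \<noteq> y"
        using xy D[of x] by blast
      then show ?thesis
        by (simp add: Pair)
    qed
  qed (use fin in auto)
  moreover have "card ?P = card (?P - ?D) + card ?D"
  proof -
    have "card ((?P - ?D) \<union> ?D) = card (?P - ?D) + card ?D"
      using fin by (intro card_Un_disjoint) auto
    moreover have "(?P - ?D) \<union> ?D = ?P"
      by auto
    ultimately show ?thesis
      by simp
  qed
  moreover have "card ?D = (if b \<in> S then 1 else 0)"
    by auto
  ultimately show ?thesis
    by (simp add: product_count_def)
qed

theorem theorem3p2:
  fixes G :: "('a, 'b) monoid_scheme"
  assumes "comm_group G" and "finite (carrier G)" and "odd (order G)"
  shows "\<not> (\<exists>S. nontrivial_sum_set G S)"
proof
  interpret comm_group G by (rule assms(1))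
  assume "\<exists>S. nontrivial_sum_set G S"
  then obtain S \<mu> where S: "S \<subseteq> carrier G" "\<not> trivial_sum_set G S"
    and \<mu>: "\<And>a. a \<in> carrier G - {\<one>\<^bsub>G\<^esub>} \<Longrightarrow> product_count G S a = \<mu>"
    unfolding nontrivial_sum_set_def sum_set_def sum_set_params_def by blast
  \<comment> \<open>The square of \<open>b\<close> is again a nonidentity element, so its number of
    factorisations is \<open>\<mu>\<close>.\<close>
  have "b \<in> S \<longleftrightarrow> odd \<mu>" if "b \<in> carrier G - {\<one>\<^bsub>G\<^esub>}" for b
    using that \<mu>[of "b \<otimes>\<^bsub>G\<^esub> b"] odd_product_count_square_iff[OF assms(2,3) S(1), of b]
      square_eq_one_odd_order[OF assms(3), of b] by auto
  \<comment> \<open>The parity of \<open>\<mu>\<close> settles all nonidentity elements at once,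
    which leaves only the membership of the identity open. All four candidates are trivial, the
    middle cases with \<open>g\<close> the identity.\<close>
  then have "S \<in> {{}, {\<one>\<^bsub>G\<^esub>}, carrier G, carrier G - {\<one>\<^bsub>G\<^esub>}}"
    using S(1) by (cases "odd \<mu>"; cases "\<one>\<^bsub>G\<^esub> \<in> S") auto
  then show False
    using S(2) unfolding trivial_sum_set_def by auto
qed

end
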